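(* Let $\tau>0$ be a uniform time step. For $\sigma\ge\frac12$, $\sigma\ne\sigma_0$ and $\theta\le\frac14$, the operator $$\mathcal S_{\rm ref}^m\boldsymbol\Phi^m:=\frac1{2h}\sum_{q=0}^mR^q\Phi^{m-q},\quad m\ge1,$$ whose kernel $R=\{R^m\}_{m\ge0}$ is the sequence of Taylor coefficients at $z=0$ of the function $d(z)\,(\nu_1(z)-\nu_2(z))$, satisfies the inequalities $$\sum_{m=1}^M\bigl(\mathcal S_{\rm ref}^m\boldsymbol\Phi^m\bigr)\Phi^{(\sigma)\,m}\,\tau\le0\quad\text{and}\quad \sum_{m=1}^M\bigl(\mathcal S_{\rm ref}^m\boldsymbol\Phi^m\bigr)\,\bar\partial_t\Phi^m\,\tau\le0\quad\text{for any }M\ge1$$ for every real sequence $\Phi=\{\Phi^m\}_{m\ge0}$ with $\Phi^0=0$.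
   Context: Here $\rho_\infty>0$, $b_\infty>0$, $c_\infty\ge0$, $h>0$, $\tau>0$ are constants and $\sigma,\theta$ are real parameters. $\boldsymbol\Phi^m=\{\Phi^1,\dots,\Phi^m\}$ (with $\Phi^0=0$), $\Phi^{(\sigma)\,m}=\sigma\Phi^m+(1-\sigma)\Phi^{m-1}$, $\bar\partial_t\Phi^m=(\Phi^m-\Phi^{m-1})/\tau$. Put $z^{(\sigma)}=\sigma+(1-\sigma)z$, $a_1=\frac{h^2\rho_\infty}{2\tau b_\infty}>0$, $a_0=\frac{h^2c_\infty}{2b_\infty}\ge0$, $$d(z)=2a_1\theta(z-1)+(1-2a_0\theta)z^{(\sigma)},\qquad \gamma(z)=1+\frac{a_1(1-z)+a_0z^{(\sigma)}}{d(z)}.$$ $\sigma_0:=\frac{2a_1\theta}{1-2a_0\theta}$ is the value of $\sigma$ for which $d(0)=0$; the condition $\sigma\ne\sigma_0$ means $d(0)\neq0$ (if $2a_0\theta=1$ it holds automatically). For such parameters (with $\sigma>0$, $\theta\le\frac14$), $\nu_1(z),\nu_2(z)$ are the two roots of $\nu^2-2\gamma(z)\nu+1=0$, analytic in a neighbourhood of $z=0$, labelled so that $0<|\nu_1(z)|<1<|\nu_2(z)|$. *)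

theory Defs
  imports "HOL-Complex_Analysis.Complex_Analysis"
begin

definition coeff_a1 :: "real \<Rightarrow> real \<Rightarrow> real \<Rightarrow> real \<Rightarrow> real" where
  "coeff_a1 \<rho> b h \<tau> = h\<^sup>2 * \<rho> / (2 * \<tau> * b)"

definition coeff_a0 :: "real \<Rightarrow> real \<Rightarrow> real \<Rightarrow> real" where
  "coeff_a0 b c h = h\<^sup>2 * c / (2 * b)"

definition z_avg :: "real \<Rightarrow> complex \<Rightarrow> complex" where
  "z_avg \<sigma> z = \<sigma> + (1 - \<sigma>) * z"

definition d_fun :: "real \<Rightarrow> real \<Rightarrow> real \<Rightarrow> real \<Rightarrow> complex \<Rightarrow> complex" where
  "d_fun a1 a0 \<sigma> \<theta> z = 2 * a1 * \<theta> * (z - 1) + (1 - 2 * a0 * \<theta>) * z_avg \<sigma> z"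

definition gamma_fun :: "real \<Rightarrow> real \<Rightarrow> real \<Rightarrow> real \<Rightarrow> complex \<Rightarrow> complex" where
  "gamma_fun a1 a0 \<sigma> \<theta> z =
     1 + (a1 * (1 - z) + a0 * z_avg \<sigma> z) / d_fun a1 a0 \<sigma> \<theta> z"

text \<open>
  If \<open>2 * a0 * \<theta> = 1\<close>, division by zero makes this \<open>0\<close>. The condition \<open>\<sigma> \<noteq> sigma0 a1 a0 \<theta>\<close> is
  then automatic for positive \<open>\<sigma>\<close>, as intended: see \<open>d_fun_0_nonzero_iff\<close>.
\<close>
definition sigma0 :: "real \<Rightarrow> real \<Rightarrow> real \<Rightarrow> real" where
  "sigma0 a1 a0 \<theta> = 2 * a1 * \<theta> / (1 - 2 * a0 * \<theta>)"

text \<open>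
  The two roots are defined pointwise by their modulus. That they exist, are unique and are
  analytic near \<open>z = 0\<close> is shown in \<open>roots_near_0\<close> and \<open>roots_analytic\<close>.
\<close>
definition nu1 :: "real \<Rightarrow> real \<Rightarrow> real \<Rightarrow> real \<Rightarrow> complex \<Rightarrow> complex" where
  "nu1 a1 a0 \<sigma> \<theta> z =
     (THE \<nu>. \<nu>\<^sup>2 - 2 * gamma_fun a1 a0 \<sigma> \<theta> z * \<nu> + 1 = 0 \<and> 0 < cmod \<nu> \<and> cmod \<nu> < 1)"

definition nu2 :: "real \<Rightarrow> real \<Rightarrow> real \<Rightarrow> real \<Rightarrow> complex \<Rightarrow> complex" where
  "nu2 a1 a0 \<sigma> \<theta> z =
     (THE \<nu>. \<nu>\<^sup>2 - 2 * gamma_fun a1 a0 \<sigma> \<theta> z * \<nu> + 1 = 0 \<and> 1 < cmod \<nu>)"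

definition kernel_fun :: "real \<Rightarrow> real \<Rightarrow> real \<Rightarrow> real \<Rightarrow> complex \<Rightarrow> complex" where
  "kernel_fun a1 a0 \<sigma> \<theta> z = d_fun a1 a0 \<sigma> \<theta> z * (nu1 a1 a0 \<sigma> \<theta> z - nu2 a1 a0 \<sigma> \<theta> z)"

text \<open>
  \<open>fps_expansion f 0\<close> is the Taylor series of \<open>f\<close> at \<open>0\<close>. The real part discards nothing, since
  the Taylor coefficients are real: see \<open>kernel_R_eq_taylor_coeff\<close>.
\<close>
definition kernel_R :: "real \<Rightarrow> real \<Rightarrow> real \<Rightarrow> real \<Rightarrow> nat \<Rightarrow> real" where
  "kernel_R a1 a0 \<sigma> \<theta> m = Re (fps_nth (fps_expansion (kernel_fun a1 a0 \<sigma> \<theta>) 0) m)"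

definition S_ref ::
  "real \<Rightarrow> real \<Rightarrow> real \<Rightarrow> real \<Rightarrow> real \<Rightarrow> real \<Rightarrow> real \<Rightarrow> (nat \<Rightarrow> real) \<Rightarrow> nat \<Rightarrow> real" where
  "S_ref \<rho> b c h \<tau> \<sigma> \<theta> \<Phi> m =
     1 / (2 * h) * (\<Sum>q=0..m. kernel_R (coeff_a1 \<rho> b h \<tau>) (coeff_a0 b c h) \<sigma> \<theta> q * \<Phi> (m - q))"

text \<open>The next two are meant for \<open>m \<ge> 1\<close> only, because of truncated subtraction.\<close>
definition avg :: "real \<Rightarrow> (nat \<Rightarrow> real) \<Rightarrow> nat \<Rightarrow> real" where
  "avg \<sigma> \<Phi> m = \<sigma> * \<Phi> m + (1 - \<sigma>) * \<Phi> (m - 1)"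

definition bdiff :: "real \<Rightarrow> (nat \<Rightarrow> real) \<Rightarrow> nat \<Rightarrow> real" where
  "bdiff \<tau> \<Phi> m = (\<Phi> m - \<Phi> (m - 1)) / \<tau>"

lemma d_fun_0_nonzero_iff:
  assumes "a1 > 0" "\<sigma> > 0"
  shows "d_fun a1 a0 \<sigma> \<theta> 0 \<noteq> 0 \<longleftrightarrow> \<sigma> \<noteq> sigma0 a1 a0 \<theta>"
proof -
  have "d_fun a1 a0 \<sigma> \<theta> 0 = of_real ((1 - 2 * a0 * \<theta>) * \<sigma> - 2 * a1 * \<theta>)"
    by (simp add: d_fun_def z_avg_def)
  hence "d_fun a1 a0 \<sigma> \<theta> 0 \<noteq> 0 \<longleftrightarrow> (1 - 2 * a0 * \<theta>) * \<sigma> \<noteq> 2 * a1 * \<theta>"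
    by (simp only: of_real_eq_0_iff) simp
  also have "\<dots> \<longleftrightarrow> \<sigma> \<noteq> sigma0 a1 a0 \<theta>"
  proof (cases "1 - 2 * a0 * \<theta> = 0")
    case True
    hence "\<theta> \<noteq> 0" by auto
    thus ?thesis using True assms by (simp add: sigma0_def)
  next
    case False
    thus ?thesis by (simp add: sigma0_def field_simps)
  qed
  finally show ?thesis .
qed

text \<open>
  Used only in the well-definedness lemmas below: where \<open>d \<noteq> 0\<close>, \<open>d * \<gamma> = d + A\<close> and
  \<open>disc = d\<^sup>2 * (\<gamma>\<^sup>2 - 1)\<close>.
\<close>
definition A_fun :: "real \<Rightarrow> real \<Rightarrow> real \<Rightarrow> complex \<Rightarrow> complex" where
  "A_fun a1 a0 \<sigma> z = a1 * (1 - z) + a0 * z_avg \<sigma> z"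

definition disc :: "real \<Rightarrow> real \<Rightarrow> real \<Rightarrow> real \<Rightarrow> complex \<Rightarrow> complex" where
  "disc a1 a0 \<sigma> \<theta> z = A_fun a1 a0 \<sigma> z * (A_fun a1 a0 \<sigma> z + 2 * d_fun a1 a0 \<sigma> \<theta> z)"

lemma real_root_bounds:
  fixes A d s :: real
  assumes "A > 0" "A + 2 * d > 0" "d \<noteq> 0" "s > 0" "s\<^sup>2 = A * (A + 2 * d)"
  shows "\<bar>d + A - s\<bar> < \<bar>d\<bar>" "\<bar>d\<bar> < \<bar>d + A + s\<bar>"
proof -
  have p: "(d + A - s) * (d + A + s) = d\<^sup>2"
    using assms(5) by (simp add: power2_eq_square algebra_simps)
  have dA: "\<bar>d\<bar> < d + A" using assms by (auto simp: abs_if)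
  thus 1: "\<bar>d\<bar> < \<bar>d + A + s\<bar>" using assms by simp
  show "\<bar>d + A - s\<bar> < \<bar>d\<bar>"
  proof (rule ccontr)
    assume "\<not> ?thesis"
    hence "\<bar>d\<bar> * \<bar>d\<bar> < \<bar>d + A - s\<bar> * \<bar>d + A + s\<bar>"
      using 1 assms(3) by (intro mult_le_less_imp_less) auto
    thus False using p by (simp add: abs_mult[symmetric] power2_eq_square)
  qed
qed

lemma eventually_cnj: "eventually P (nhds 0) \<Longrightarrow> eventually (\<lambda>z. P (cnj z)) (nhds 0)"
proof -
  assume "eventually P (nhds 0)"
  moreover have "(cnj \<longlongrightarrow> cnj 0) (nhds 0)" by (intro tendsto_intros) (simp add: filterlim_ident)
  ultimately show ?thesis by (simp add: filterlim_iff)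
qed

lemma higher_deriv_cnj:
  assumes "f analytic_on {0}" "eventually (\<lambda>z. f (cnj z) = cnj (f z)) (nhds 0)"
  shows "eventually (\<lambda>z. (deriv ^^ n) f (cnj z) = cnj ((deriv ^^ n) f z)) (nhds 0)"
proof (induction n)
  case 0
  thus ?case using assms by simp
next
  case (Suc n)
  define g where "g = (deriv ^^ n) f"
  have "g analytic_on {0}" unfolding g_def by (intro analytic_intros assms)
  hence "eventually (\<lambda>z. g analytic_on {z}) (nhds 0)"
    unfolding analytic_at[of g 0] eventually_nhds using analytic_at[of g] by blast
  moreover have "eventually (\<lambda>z. eventually (\<lambda>w. g (cnj w) = cnj (g w)) (nhds z)) (nhds 0)"
    using Suc.IH by (simp add: eventually_eventually g_def)
  ultimately have "eventually (\<lambda>z. deriv g (cnj z) = cnj (deriv g z)) (nhds 0)"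
  proof eventually_elim
    case (elim z)
    have "(g has_field_derivative deriv g z) (at z)"
      using elim(1) analytic_on_imp_differentiable_at DERIV_deriv_iff_field_differentiable by blast
    hence "(cnj \<circ> g \<circ> cnj has_field_derivative cnj (deriv g z)) (at (cnj z))"
      by (intro has_field_derivative_cnj_cnj) simp
    moreover have "eventually (\<lambda>w. (cnj \<circ> g \<circ> cnj) w = g w) (nhds (cnj z))"
    proof -
      have "(cnj \<longlongrightarrow> z) (nhds (cnj z))"
        using tendsto_cnj[OF filterlim_ident, of "cnj z"] by simp
      hence "eventually (\<lambda>w. g (cnj (cnj w)) = cnj (g (cnj w))) (nhds (cnj z))"
        by (rule eventually_compose_filterlim[OF elim(2)])
      thus ?thesis by eventually_elim simp
    qed
    ultimately have "(g has_field_derivative cnj (deriv g z)) (at (cnj z))"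
      using DERIV_cong_ev[OF refl _ refl] by metis
    thus ?case by (rule DERIV_imp_deriv)
  qed
  thus ?case by (simp add: g_def)
qed

context
  fixes a1 a0 \<sigma> \<theta> :: real
  assumes pos: "a1 > 0" "a0 \<ge> 0" "\<sigma> > 0" "\<theta> \<le> 1 / 4" "\<sigma> \<noteq> sigma0 a1 a0 \<theta>"
begin

private abbreviation "A \<equiv> A_fun a1 a0 \<sigma>"
private abbreviation "d \<equiv> d_fun a1 a0 \<sigma> \<theta>"
private abbreviation "s \<equiv> \<lambda>z. csqrt (disc a1 a0 \<sigma> \<theta> z)"

lemma disc_0: "\<exists>r>0. disc a1 a0 \<sigma> \<theta> 0 = of_real r"
  and roots_at_0: "d 0 \<noteq> 0" "cmod (d 0 + A 0 - s 0) < cmod (d 0)"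
    "cmod (d 0) < cmod (d 0 + A 0 + s 0)"
proof -
  define x where "x = a1 + a0 * \<sigma>"
  define y where "y = (1 - 2 * a0 * \<theta>) * \<sigma> - 2 * a1 * \<theta>"
  have Ax: "A 0 = of_real x" by (simp add: A_fun_def z_avg_def x_def)
  have dy: "d 0 = of_real y" by (simp add: d_fun_def z_avg_def y_def)
  show d0: "d 0 \<noteq> 0" using d_fun_0_nonzero_iff pos by blast
  hence y: "y \<noteq> 0" using dy by auto
  have x: "x > 0" using pos by (simp add: x_def add_pos_nonneg)
  have xy: "x + 2 * y > 0"
  proof -
    have "x + 2 * y = (a1 + a0 * \<sigma>) * (1 - 4 * \<theta>) + 2 * \<sigma>"
      by (simp add: x_def y_def algebra_simps)
    moreover have "(a1 + a0 * \<sigma>) * (1 - 4 * \<theta>) \<ge> 0"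
      using pos by (intro mult_nonneg_nonneg) auto
    ultimately show ?thesis using pos by linarith
  qed
  have disc: "disc a1 a0 \<sigma> \<theta> 0 = of_real (x * (x + 2 * y))"
    by (simp add: disc_def Ax dy)
  have r: "x * (x + 2 * y) > 0" using x xy by simp
  show "\<exists>r>0. disc a1 a0 \<sigma> \<theta> 0 = of_real r" using disc r by blast
  define t where "t = sqrt (x * (x + 2 * y))"
  have s: "s 0 = of_real t" unfolding disc t_def using r by (subst of_real_sqrt) auto
  have t: "t > 0" "t\<^sup>2 = x * (x + 2 * y)" using r by (auto simp: t_def)
  note b = real_root_bounds[OF x xy y t]
  show "cmod (d 0 + A 0 - s 0) < cmod (d 0)" "cmod (d 0) < cmod (d 0 + A 0 + s 0)"
    unfolding Ax dy s using b
    by (simp_all flip: of_real_add of_real_diff)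
qed

lemma A_d_analytic: "A analytic_on S" "d analytic_on S" "disc a1 a0 \<sigma> \<theta> analytic_on S"
  unfolding A_fun_def[abs_def] d_fun_def[abs_def] disc_def[abs_def] z_avg_def
  by (auto intro!: analytic_intros)

lemma disc_0_nonpos: "disc a1 a0 \<sigma> \<theta> 0 \<notin> \<real>\<^sub>\<le>\<^sub>0"
  using disc_0 by auto

lemma s_analytic: "s analytic_on {0}"
  by (rule analytic_on_csqrt') (use A_d_analytic disc_0_nonpos in auto)

lemma roots_eventually:
  "eventually (\<lambda>z. d z \<noteq> 0 \<and> disc a1 a0 \<sigma> \<theta> z \<notin> \<real>\<^sub>\<le>\<^sub>0 \<and>
     cmod (d z + A z - s z) < cmod (d z) \<and> cmod (d z) < cmod (d z + A z + s z)) (nhds 0)"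
proof -
  have c: "isCont A 0" "isCont d 0" "isCont (disc a1 a0 \<sigma> \<theta>) 0" "isCont s 0"
    using A_d_analytic[of "{0}"] s_analytic by (auto intro: analytic_at_imp_isCont)
  have l: "(A \<longlongrightarrow> A 0) (nhds 0)" "(d \<longlongrightarrow> d 0) (nhds 0)" "(s \<longlongrightarrow> s 0) (nhds 0)"
    "(disc a1 a0 \<sigma> \<theta> \<longlongrightarrow> disc a1 a0 \<sigma> \<theta> 0) (nhds 0)"
    using c[unfolded isCont_def, THEN iffD1[OF tendsto_at_iff_tendsto_nhds]] by blast+
  have "eventually (\<lambda>z. d z \<noteq> 0) (nhds 0)"
    using roots_at_0(1) l(2) by (auto intro: tendsto_imp_eventually_ne)
  moreover have "eventually (\<lambda>z. disc a1 a0 \<sigma> \<theta> z \<in> - \<real>\<^sub>\<le>\<^sub>0) (nhds 0)"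
    by (rule topological_tendstoD[OF l(4)]) (use disc_0_nonpos in auto)
  moreover have "eventually (\<lambda>z. 0 < cmod (d z) - cmod (d z + A z - s z)) (nhds 0)"
    by (rule order_tendstoD(1)[of _ "cmod (d 0) - cmod (d 0 + A 0 - s 0)"])
       (use roots_at_0 in \<open>auto intro!: tendsto_intros l\<close>)
  moreover have "eventually (\<lambda>z. 0 < cmod (d z + A z + s z) - cmod (d z)) (nhds 0)"
    by (rule order_tendstoD(1)[of _ "cmod (d 0 + A 0 + s 0) - cmod (d 0)"])
       (use roots_at_0 in \<open>auto intro!: tendsto_intros l\<close>)
  ultimately show ?thesis by eventually_elim auto
qed

lemma roots_explicit:
  "eventually (\<lambda>z. nu1 a1 a0 \<sigma> \<theta> z = (d z + A z - s z) / d z \<and>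
     nu2 a1 a0 \<sigma> \<theta> z = (d z + A z + s z) / d z \<and>
     0 < cmod (nu1 a1 a0 \<sigma> \<theta> z) \<and> cmod (nu1 a1 a0 \<sigma> \<theta> z) < 1 \<and> 1 < cmod (nu2 a1 a0 \<sigma> \<theta> z) \<and>
     (\<forall>\<nu>. \<nu>\<^sup>2 - 2 * gamma_fun a1 a0 \<sigma> \<theta> z * \<nu> + 1 =
        (\<nu> - nu1 a1 a0 \<sigma> \<theta> z) * (\<nu> - nu2 a1 a0 \<sigma> \<theta> z))) (nhds 0)"
  using roots_eventually
proof eventually_elim
  case (elim z)
  define u v where "u = (d z + A z - s z) / d z" and "v = (d z + A z + s z) / d z"
  have s2: "(s z)\<^sup>2 = A z * (A z + 2 * d z)" by (simp add: disc_def)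
  have "u + v = 2 * gamma_fun a1 a0 \<sigma> \<theta> z"
    using elim by (simp add: u_def v_def gamma_fun_def A_fun_def field_simps)
  moreover have "u * v = 1"
  proof -
    have "(d z + A z - s z) * (d z + A z + s z) = (d z)\<^sup>2"
      using s2 by (simp add: power2_eq_square algebra_simps)
    thus ?thesis using elim by (simp add: u_def v_def power2_eq_square)
  qed
  ultimately have f: "\<nu>\<^sup>2 - 2 * gamma_fun a1 a0 \<sigma> \<theta> z * \<nu> + 1 = (\<nu> - u) * (\<nu> - v)" for \<nu>
  proof -
    have "(\<nu> - u) * (\<nu> - v) = \<nu>\<^sup>2 - (u + v) * \<nu> + u * v"
      by (simp add: power2_eq_square algebra_simps)
    thus ?thesis using \<open>u + v = _\<close> \<open>u * v = 1\<close> by simp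
  qed
  have b: "cmod u < 1" "1 < cmod v" using elim by (auto simp: u_def v_def norm_divide)
  have u0: "u \<noteq> 0" using \<open>u * v = 1\<close> by auto
  have 1: "nu1 a1 a0 \<sigma> \<theta> z = u" unfolding nu1_def f
    by (rule the_equality) (use b u0 in auto)
  have 2: "nu2 a1 a0 \<sigma> \<theta> z = v" unfolding nu2_def f
    by (rule the_equality) (use b in auto)
  show ?case using b u0 f unfolding 1 2 by (auto simp: u_def v_def)
qed

lemma roots_near_0:
  "eventually (\<lambda>z. 0 < cmod (nu1 a1 a0 \<sigma> \<theta> z) \<and> cmod (nu1 a1 a0 \<sigma> \<theta> z) < 1 \<and>
     1 < cmod (nu2 a1 a0 \<sigma> \<theta> z) \<and>
     (\<forall>\<nu>. \<nu>\<^sup>2 - 2 * gamma_fun a1 a0 \<sigma> \<theta> z * \<nu> + 1 =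
        (\<nu> - nu1 a1 a0 \<sigma> \<theta> z) * (\<nu> - nu2 a1 a0 \<sigma> \<theta> z))) (nhds 0)"
  using roots_explicit by eventually_elim auto

lemma roots_analytic: "nu1 a1 a0 \<sigma> \<theta> analytic_on {0}" "nu2 a1 a0 \<sigma> \<theta> analytic_on {0}"
proof -
  have "(\<lambda>z. (d z + A z - s z) / d z) analytic_on {0}"
    using roots_at_0(1) A_d_analytic s_analytic by (auto intro!: analytic_intros)
  moreover have "(\<lambda>z. (d z + A z + s z) / d z) analytic_on {0}"
    using roots_at_0(1) A_d_analytic s_analytic by (auto intro!: analytic_intros)
  moreover have "eventually (\<lambda>z. nu1 a1 a0 \<sigma> \<theta> z = (d z + A z - s z) / d z) (nhds 0)"
    using roots_explicit by eventually_elim auto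
  moreover have "eventually (\<lambda>z. nu2 a1 a0 \<sigma> \<theta> z = (d z + A z + s z) / d z) (nhds 0)"
    using roots_explicit by eventually_elim auto
  ultimately show "nu1 a1 a0 \<sigma> \<theta> analytic_on {0}" "nu2 a1 a0 \<sigma> \<theta> analytic_on {0}"
    by (simp_all cong: analytic_at_cong)
qed

lemma kernel_fun_analytic: "kernel_fun a1 a0 \<sigma> \<theta> analytic_on {0}"
  unfolding kernel_fun_def[abs_def]
  using roots_analytic A_d_analytic by (auto intro!: analytic_intros)

lemma kernel_fun_explicit: "eventually (\<lambda>z. kernel_fun a1 a0 \<sigma> \<theta> z = - 2 * s z) (nhds 0)"
  using roots_explicit roots_eventually
  by eventually_elim (auto simp: kernel_fun_def field_simps)

lemma kernel_R_eq_taylor_coeff: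
  "complex_of_real (kernel_R a1 a0 \<sigma> \<theta> m) =
     fps_nth (fps_expansion (kernel_fun a1 a0 \<sigma> \<theta>) 0) m"
proof -
  have cd: "disc a1 a0 \<sigma> \<theta> (cnj z) = cnj (disc a1 a0 \<sigma> \<theta> z)" for z
    by (simp add: disc_def A_fun_def d_fun_def z_avg_def)
  have "eventually (\<lambda>z. kernel_fun a1 a0 \<sigma> \<theta> (cnj z) = cnj (kernel_fun a1 a0 \<sigma> \<theta> z)) (nhds 0)"
    using kernel_fun_explicit eventually_cnj[OF kernel_fun_explicit] roots_eventually
    by eventually_elim (simp add: cd cnj_csqrt)
  hence "(deriv ^^ m) (kernel_fun a1 a0 \<sigma> \<theta>) (cnj 0) =
      cnj ((deriv ^^ m) (kernel_fun a1 a0 \<sigma> \<theta>) 0)"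
    using higher_deriv_cnj[OF kernel_fun_analytic] eventually_nhds_x_imp_x by blast
  hence "(deriv ^^ m) (kernel_fun a1 a0 \<sigma> \<theta>) 0 \<in> \<real>"
    by (simp add: Reals_cnj_iff)
  moreover have "complex_of_real (fact m) \<in> \<real>"
    by (rule Reals_of_real)
  ultimately have "fps_nth (fps_expansion (kernel_fun a1 a0 \<sigma> \<theta>) 0) m \<in> \<real>"
    by (simp add: fps_expansion_def Reals_divide)
  thus ?thesis by (simp add: kernel_R_def)
qed

end

end

theory Submission
  imports Defs
begin

text \<open>
  Near \<open>z = 0\<close> the kernel function \<open>d * (nu1 - nu2)\<close> equals \<open>- 2 * sqrt (A * B)\<close>, where, with
  \<open>w = z_avg \<sigma>\<close>,
  \<open>A = a1 * (1 - z) + a0 * w\<close> and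
  \<open>B = A + 2 * d = a1 * (1 - 4 * \<theta>) * (1 - z) + (a0 * (1 - 4 * \<theta>) + 2) * w\<close>.
  For \<open>\<theta> \<le> 1 / 4\<close> all these coefficients are nonnegative. The sequences \<open>avg \<sigma> \<Phi>\<close> and
  \<open>\<tau> * bdiff \<tau> \<Phi>\<close> have the generating functions \<open>w * \<Phi>\<close> and \<open>(1 - z) * \<Phi>\<close>. Both inequalities
  therefore say that convolution with \<open>F\<close> has a nonnegative quadratic form on every initial
  segment, for \<open>F = sqrt (A * B) / w\<close> and for \<open>F = sqrt (A * B) / (1 - z)\<close>.

  Analytically, this holds because \<open>(1 - z) / w\<close> maps the unit disc to the right half plane when
  \<open>\<sigma> \<ge> 1 / 2\<close>, and because the square root of a product of two numbers of the right half plane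
  lies there too. The argument below replaces the half plane by the cone of real formal power
  series with nonnegative quadratic forms (\<open>positive_kernel\<close>), so that no boundary values or
  convergence questions arise. The cone is closed under sums and under reciprocals
  (\<open>positive_kernel_inverse\<close>). It is also closed under geometric means
  (\<open>positive_kernel_geometric_mean\<close>), since the arithmetic-harmonic mean iteration stays in the
  cone and, started from two series with the same constant term, agrees with its limit up to any
  given order after finitely many steps. Finally \<open>(1 - z) / w\<close> belongs to the cone by a telescoping
  energy identity (\<open>positive_kernel_difference_over_average\<close>).
\<close>

section \<open>The cone of positive convolution kernels\<close>

text \<open>
  By the Caratheodory-Toeplitz theorem these are the Taylor series with real coefficients of the
  functions on the unit disc with nonnegative real part.
\<close>

definition positive_kernel :: "real fps \<Rightarrow> bool" where
  "positive_kernel F \<longleftrightarrow> (\<forall>G M. 0 \<le> (\<Sum>m\<le>M. fps_nth (F * G) m * fps_nth G m))"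

lemma positive_kernelD:
  "positive_kernel F \<Longrightarrow> 0 \<le> (\<Sum>m\<le>M. fps_nth (F * G) m * fps_nth G m)"
  by (simp add: positive_kernel_def)

lemma positive_kernel_1: "positive_kernel 1"
  by (auto simp: positive_kernel_def intro!: sum_nonneg)

lemma positive_kernel_add:
  assumes "positive_kernel F" "positive_kernel G"
  shows "positive_kernel (F + G)"
  using assms by (simp add: positive_kernel_def distrib_right sum.distrib)

lemma positive_kernel_scale:
  assumes "positive_kernel F" "c \<ge> 0"
  shows "positive_kernel (fps_const c * F)"
  using assms
  by (simp add: positive_kernel_def mult.assoc flip: sum_distrib_left)

text \<open>
  The next two lemmas are the change of variables \<open>G \<mapsto> Q * G\<close>. It respects initial segments
  because \<open>Q\<close> and its reciprocal are both power series.
\<close>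

lemma positive_kernel_quotientI:
  assumes "fps_nth Q 0 \<noteq> 0"
  assumes "\<And>G M. 0 \<le> (\<Sum>m\<le>M. fps_nth (P * G) m * fps_nth (Q * G) m)"
  shows "positive_kernel (P * inverse Q)"
  unfolding positive_kernel_def
proof (intro allI)
  fix G M
  have QG: "Q * (inverse Q * G) = G"
    using assms(1) by (simp add: inverse_mult_eq_1' flip: mult.assoc)
  thus "0 \<le> (\<Sum>m\<le>M. fps_nth (P * inverse Q * G) m * fps_nth G m)"
    using assms(2)[where G = "inverse Q * G" and M = M] by (simp only: mult.assoc QG)
qed

lemma positive_kernel_quotientD:
  assumes "positive_kernel (P * inverse Q)" "fps_nth Q 0 \<noteq> 0"
  shows "0 \<le> (\<Sum>m\<le>M. fps_nth (P * G) m * fps_nth (Q * G) m)"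
proof -
  have PG: "P * inverse Q * (Q * G) = P * G"
    using assms(2) by (simp add: inverse_mult_eq_1 mult.assoc flip: mult.assoc[of "inverse Q"])
  thus ?thesis
    using positive_kernelD[OF assms(1), where G = "Q * G" and M = M] by (simp only: PG)
qed

text \<open>The quadratic form of \<open>P / Q\<close> at \<open>Q * G\<close> is that of \<open>Q / P\<close> at \<open>P * G\<close>.\<close>

lemma positive_kernel_quotient_swap:
  assumes "positive_kernel (P * inverse Q)" "fps_nth P 0 \<noteq> 0" "fps_nth Q 0 \<noteq> 0"
  shows "positive_kernel (Q * inverse P)"
  using positive_kernel_quotientD[OF assms(1,3)] assms(2)
  by (intro positive_kernel_quotientI) (simp_all add: mult.commute)

lemma positive_kernel_inverse:
  assumes "positive_kernel F" "fps_nth F 0 \<noteq> 0"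
  shows "positive_kernel (inverse F)"
  using positive_kernel_quotient_swap[of F 1] assms by simp

section \<open>Geometric means of positive kernels\<close>

text \<open>
  One step of the iteration \<open>x' = (x + y) / 2\<close>, \<open>1 / y' = (1 / x + 1 / y) / 2\<close> preserves the product
  \<open>x * y = S\<^sup>2\<close>, and \<open>2 * x * (x' - S) = (x - S)\<^sup>2\<close>. The order of vanishing of \<open>x - S\<close> thus
  doubles, of which an increase by one is enough.
\<close>

lemma arithmetic_harmonic_iteration:
  assumes "positive_kernel X" "positive_kernel Y" "X * Y = S\<^sup>2"
    "fps_nth X 0 = fps_nth S 0" "fps_nth Y 0 = fps_nth S 0" "fps_nth S 0 \<noteq> 0"
  shows "\<exists>x y. positive_kernel x \<and> positive_kernel y \<and> x * y = S\<^sup>2 \<and>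
    fps_nth x 0 = fps_nth S 0 \<and> fps_nth y 0 = fps_nth S 0 \<and> fps_X ^ Suc k dvd x - S"
proof (induction k)
  case 0
  have "X - S = 0 \<or> subdegree (X - S) > 0"
    using assms(4) by (auto simp: subdegree_eq_0_iff)
  hence "fps_X dvd X - S"
    by (cases "X - S = 0") (simp_all add: fps_dvd_iff)
  thus ?case using assms by (intro exI[of _ X] exI[of _ Y]) simp
next
  case (Suc k)
  then obtain x y where xy: "positive_kernel x" "positive_kernel y" "x * y = S\<^sup>2"
    "fps_nth x 0 = fps_nth S 0" "fps_nth y 0 = fps_nth S 0" "fps_X ^ Suc k dvd x - S"
    by blast
  define half :: "real fps" where "half = fps_const (1 / 2)"
  have half: "half + half = 1" by (simp add: half_def)
  define x' where "x' = half * (x + y)"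
  define v where "v = half * (inverse x + inverse y)"
  have ix: "x * inverse x = 1" and iy: "y * inverse y = 1"
    using xy(4,5) assms(6) by (auto simp: inverse_mult_eq_1')
  have x'0: "fps_nth x' 0 = fps_nth S 0"
    using xy(4,5) by (simp add: x'_def half_def)
  have v0: "fps_nth v 0 = inverse (fps_nth S 0)"
    using xy(4,5) by (simp add: v_def half_def)
  have iv: "v * inverse v = 1" using v0 assms(6) by (simp add: inverse_mult_eq_1')
  have "S\<^sup>2 * v = half * ((x * inverse x) * y + (y * inverse y) * x)"
    unfolding v_def xy(3)[symmetric] by (simp add: algebra_simps)
  hence Sv: "S\<^sup>2 * v = x'" by (simp add: ix iy x'_def algebra_simps)
  have prod: "x' * inverse v = S\<^sup>2"
    using iv by (simp add: Sv[symmetric] mult.assoc)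
  have px: "positive_kernel x'"
    unfolding x'_def half_def by (intro positive_kernel_scale positive_kernel_add xy) simp
  have pv: "positive_kernel v"
    unfolding v_def half_def
    by (intro positive_kernel_scale positive_kernel_add positive_kernel_inverse xy)
       (use xy(4,5) assms(6) in auto)
  have py: "positive_kernel (inverse v)"
    using pv v0 assms(6) by (intro positive_kernel_inverse) auto
  have "x * (x' - S) = half * (x * x + x * y) - (half + half) * (x * S)"
    by (simp add: x'_def half algebra_simps)
  also have "\<dots> = half * (x - S)\<^sup>2"
    unfolding xy(3) by (simp add: power2_eq_square algebra_simps)
  finally have newton: "x' - S = inverse x * half * (x - S)\<^sup>2"
    using ix by (metis (no_types, lifting) mult.assoc mult.commute mult_1)
  have "fps_X ^ Suc (Suc k) dvd (fps_X ^ Suc k * fps_X ^ Suc k :: real fps)"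
    by (simp flip: power_add add: le_imp_power_dvd)
  also have "\<dots> dvd (x - S)\<^sup>2"
    unfolding power2_eq_square by (intro mult_dvd_mono xy)
  finally have "fps_X ^ Suc (Suc k) dvd x' - S"
    unfolding newton by (rule dvd_mult)
  moreover have "fps_nth (inverse v) 0 = fps_nth S 0" by (simp add: v0)
  ultimately show ?case using px py prod x'0 by blast
qed

lemma positive_kernel_geometric_mean_normalized:
  assumes "positive_kernel X" "positive_kernel Y" "X * Y = S\<^sup>2"
    "fps_nth X 0 = fps_nth S 0" "fps_nth Y 0 = fps_nth S 0" "fps_nth S 0 \<noteq> 0"
  shows "positive_kernel S"
  unfolding positive_kernel_def
proof (intro allI)
  fix G M
  \<comment> \<open>The form on \<open>{..M}\<close> sees the kernel only up to order \<open>M\<close>.\<close>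
  from arithmetic_harmonic_iteration[OF assms, of M]
  obtain x where x: "positive_kernel x" "fps_X ^ Suc M dvd x - S" by blast
  from x(2) obtain H where H: "x - S = fps_X ^ Suc M * H" by (elim dvdE)
  have "fps_nth (S * G) m = fps_nth (x * G) m" if "m \<le> M" for m
  proof -
    have "x * G - S * G = fps_X ^ Suc M * (H * G)"
      using H by (metis left_diff_distrib mult.assoc)
    moreover have "fps_nth (fps_X ^ Suc M * (H * G)) m = 0"
      using that by (simp only: fps_X_power_mult_nth) simp
    ultimately have "fps_nth (x * G - S * G) m = 0" by simp
    thus ?thesis by simp
  qed
  hence "(\<Sum>m\<le>M. fps_nth (S * G) m * fps_nth G m) = (\<Sum>m\<le>M. fps_nth (x * G) m * fps_nth G m)"
    by (intro sum.cong) auto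
  thus "0 \<le> (\<Sum>m\<le>M. fps_nth (S * G) m * fps_nth G m)"
    using positive_kernelD[OF x(1)] by simp
qed

text \<open>
  Scaling \<open>X\<close> by \<open>s\<close> and \<open>Y\<close> by \<open>1 / s\<close> keeps their product and, for a suitable \<open>s\<close>, makes the
  constant terms equal. Without this the iteration would converge only in the limit.
\<close>

lemma positive_kernel_geometric_mean:
  assumes "positive_kernel X" "positive_kernel Y" "X * Y = S\<^sup>2"
    "fps_nth X 0 > 0" "fps_nth S 0 > 0"
  shows "positive_kernel S"
proof -
  define s where "s = fps_nth S 0 / fps_nth X 0"
  have s: "s > 0" using assms by (simp add: s_def)
  have XY0: "fps_nth X 0 * fps_nth Y 0 = (fps_nth S 0)\<^sup>2"
    using arg_cong[OF assms(3), of "\<lambda>F. fps_nth F 0"] by (simp add: power2_eq_square)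
  show ?thesis
  proof (rule positive_kernel_geometric_mean_normalized)
    show "positive_kernel (fps_const s * X)" "positive_kernel (fps_const (inverse s) * Y)"
      using s assms by (auto intro: positive_kernel_scale)
    have "fps_const s * X * (fps_const (inverse s) * Y) = fps_const (s * inverse s) * (X * Y)"
      by (simp only: fps_const_mult[symmetric] mult_ac)
    thus "fps_const s * X * (fps_const (inverse s) * Y) = S\<^sup>2"
      using s assms(3) by simp
    show "fps_nth (fps_const s * X) 0 = fps_nth S 0"
      using assms by (simp add: s_def)
    show "fps_nth (fps_const (inverse s) * Y) 0 = fps_nth S 0"
      using XY0 assms by (simp add: s_def field_simps power2_eq_square)
    show "fps_nth S 0 \<noteq> 0" using assms by simp
  qed
qed

text \<open>
  After division by \<open>W\<close> the two factors become affine functions of \<open>V / W\<close> with nonnegative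
  coefficients, hence positive kernels, and \<open>S / W\<close> is their geometric mean.
\<close>

lemma positive_kernel_sqrt_product_over:
  assumes "positive_kernel (V * inverse W)" "fps_nth V 0 > 0" "fps_nth W 0 > 0"
    and "p \<ge> 0" "q \<ge> 0" "p > 0 \<or> q > 0" "p' \<ge> 0" "q' \<ge> 0"
    and "(fps_const p * V + fps_const q * W) * (fps_const p' * V + fps_const q' * W) = S\<^sup>2"
    and "fps_nth S 0 > 0"
  shows "positive_kernel (S * inverse W)"
proof (rule positive_kernel_geometric_mean)
  define U where "U = V * inverse W"
  have iW: "W * inverse W = 1" using assms(3) by (simp add: inverse_mult_eq_1')
  have pos: "positive_kernel (fps_const a * U + fps_const b)" if "a \<ge> 0" "b \<ge> 0" for a b
    using positive_kernel_add[OF positive_kernel_scale[OF assms(1) that(1)]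
        positive_kernel_scale[OF positive_kernel_1 that(2)]]
    by (simp add: U_def)
  show "positive_kernel (fps_const p * U + fps_const q)"
    "positive_kernel (fps_const p' * U + fps_const q')" using pos assms by auto
  have quot: "(fps_const a * V + fps_const b * W) * inverse W = fps_const a * U + fps_const b" for a b
    by (simp add: U_def distrib_right mult.assoc iW)
  show "(fps_const p * U + fps_const q) * (fps_const p' * U + fps_const q') = (S * inverse W)\<^sup>2"
    unfolding quot[symmetric] power_mult_distrib assms(9)[symmetric]
    by (simp only: power2_eq_square mult_ac)
  have U0: "fps_nth U 0 > 0" using assms(2,3) by (simp add: U_def)
  show "fps_nth (fps_const p * U + fps_const q) 0 > 0"
    using assms(4-6) U0 by (auto intro: add_pos_nonneg add_nonneg_pos)
  show "fps_nth (S * inverse W) 0 > 0" using assms by simp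
qed

section \<open>Differences and weighted averages\<close>

definition diff_fps :: "real fps" where
  "diff_fps = 1 - fps_X"

definition avg_fps :: "real \<Rightarrow> real fps" where
  "avg_fps \<sigma> = fps_const \<sigma> + fps_const (1 - \<sigma>) * fps_X"

lemma diff_fps_mult_nth:
  "fps_nth (diff_fps * G) m = fps_nth G m - (if m = 0 then 0 else fps_nth G (m - 1))"
  by (simp add: diff_fps_def left_diff_distrib)

lemma avg_fps_mult_nth:
  "fps_nth (avg_fps \<sigma> * G) m =
     \<sigma> * fps_nth G m + (1 - \<sigma>) * (if m = 0 then 0 else fps_nth G (m - 1))"
  by (simp add: avg_fps_def distrib_right mult.assoc)

text \<open>
  With \<open>x = G m\<close> and \<open>y = G (m - 1)\<close>, the summand is
  \<open>(\<sigma> - 1 / 2) * (x - y)\<^sup>2 + (x\<^sup>2 - y\<^sup>2) / 2\<close>, and the second part telescopes.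
\<close>

lemma positive_kernel_difference_over_average:
  assumes "\<sigma> \<ge> 1 / 2"
  shows "positive_kernel (diff_fps * inverse (avg_fps \<sigma>))"
proof (rule positive_kernel_quotientI)
  show "fps_nth (avg_fps \<sigma>) 0 \<noteq> 0" using assms by (simp add: avg_fps_def)
  fix G :: "real fps" and M
  have "(fps_nth G M)\<^sup>2 / 2 \<le> (\<Sum>m\<le>M. fps_nth (diff_fps * G) m * fps_nth (avg_fps \<sigma> * G) m)"
  proof (induction M)
    case 0
    have "(fps_nth G 0)\<^sup>2 * (1 / 2) \<le> (fps_nth G 0)\<^sup>2 * \<sigma>"
      using assms by (intro mult_left_mono) auto
    thus ?case by (simp add: diff_fps_def avg_fps_def power2_eq_square mult_ac)
  next
    case (Suc M)
    define x y where "x = fps_nth G (Suc M)" and "y = fps_nth G M"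
    have "0 \<le> (\<sigma> - 1 / 2) * (x - y)\<^sup>2" using assms by simp
    also have "\<dots> = (x - y) * (\<sigma> * x + (1 - \<sigma>) * y) - (x\<^sup>2 / 2 - y\<^sup>2 / 2)"
      by (simp add: power2_eq_square field_simps)
    finally show ?case
      using Suc.IH by (simp add: diff_fps_mult_nth avg_fps_mult_nth x_def y_def)
  qed
  thus "0 \<le> (\<Sum>m\<le>M. fps_nth (diff_fps * G) m * fps_nth (avg_fps \<sigma> * G) m)"
    by (rule order_trans[rotated]) simp
qed

section \<open>The kernel as a square root\<close>

definition kernel_fps :: "real \<Rightarrow> real \<Rightarrow> real \<Rightarrow> real \<Rightarrow> real fps" where
  "kernel_fps a1 a0 \<sigma> \<theta> = Abs_fps (kernel_R a1 a0 \<sigma> \<theta>)"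

text \<open>
  The kernel function is complex and the positivity argument is real. The injective homomorphism
  \<open>complex_fps\<close> carries the identity for the square of the kernel from one to the other.
\<close>

definition complex_fps :: "real fps \<Rightarrow> complex fps" where
  "complex_fps F = Abs_fps (\<lambda>n. of_real (fps_nth F n))"

lemma complex_fps_hom:
  "complex_fps (F + G) = complex_fps F + complex_fps G"
  "complex_fps (F * G) = complex_fps F * complex_fps G"
  "complex_fps (fps_const x) = fps_const (of_real x)"
  "complex_fps diff_fps = 1 - fps_X"
  "complex_fps (avg_fps \<sigma>) = fps_const (of_real \<sigma>) + fps_const (1 - of_real \<sigma>) * fps_X"
proof -
  show "complex_fps (F * G) = complex_fps F * complex_fps G"
    by (simp add: complex_fps_def fps_eq_iff fps_mult_nth)
qed (auto simp: complex_fps_def diff_fps_def avg_fps_def fps_eq_iff)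

lemma complex_fps_eq_iff: "complex_fps F = complex_fps G \<longleftrightarrow> F = G"
  by (auto simp: complex_fps_def fps_eq_iff)

context
  fixes a1 a0 \<sigma> \<theta> :: real
  assumes pos: "a1 > 0" "a0 \<ge> 0" "\<sigma> > 0" "\<theta> \<le> 1 / 4" "\<sigma> \<noteq> sigma0 a1 a0 \<theta>"
begin

text \<open>
  Near \<open>0\<close> the kernel function is \<open>- 2 * csqrt disc\<close> with \<open>disc = A * (A + 2 * d)\<close>. In \<open>A + 2 * d\<close>
  the two terms of \<open>d\<close> that contain \<open>\<theta>\<close> turn \<open>a1\<close> and \<open>a0\<close> into \<open>a1 * (1 - 4 * \<theta>)\<close> and
  \<open>a0 * (1 - 4 * \<theta>)\<close>. This is where \<open>\<theta> \<le> 1 / 4\<close> gives the right signs.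
\<close>

lemma kernel_fps_square:
  "(kernel_fps a1 a0 \<sigma> \<theta>)\<^sup>2 = fps_const 4 *
     ((fps_const a1 * diff_fps + fps_const a0 * avg_fps \<sigma>) *
      (fps_const (a1 * (1 - 4 * \<theta>)) * diff_fps +
       fps_const (a0 * (1 - 4 * \<theta>) + 2) * avg_fps \<sigma>))"
  (is "_ = ?P")
proof -
  let ?k = "kernel_fun a1 a0 \<sigma> \<theta>"
  have K: "complex_fps (kernel_fps a1 a0 \<sigma> \<theta>) = fps_expansion ?k 0"
    by (simp add: fps_eq_iff complex_fps_def kernel_fps_def kernel_R_eq_taylor_coeff[OF pos])
  have "?k has_fps_expansion complex_fps (kernel_fps a1 a0 \<sigma> \<theta>)"
    unfolding K using kernel_fun_analytic[OF pos] by (rule analytic_at_imp_has_fps_expansion_0)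
  hence 1: "(\<lambda>z. (?k z)\<^sup>2) has_fps_expansion complex_fps ((kernel_fps a1 a0 \<sigma> \<theta>)\<^sup>2)"
    unfolding power2_eq_square complex_fps_hom by (intro fps_expansion_intros)
  have 2: "(\<lambda>z. of_real 4 * ((of_real a1 * (1 - z) + of_real a0 * (of_real \<sigma> + (1 - of_real \<sigma>) * z)) *
      (of_real (a1 * (1 - 4 * \<theta>)) * (1 - z) +
       of_real (a0 * (1 - 4 * \<theta>) + 2) * (of_real \<sigma> + (1 - of_real \<sigma>) * z))))
      has_fps_expansion complex_fps ?P" (is "?g has_fps_expansion _")
    unfolding complex_fps_hom by (intro fps_expansion_intros)
  have "eventually (\<lambda>z. (?k z)\<^sup>2 = ?g z) (nhds 0)"
    using kernel_fun_explicit[OF pos]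
  proof eventually_elim
    case (elim z)
    have "(?k z)\<^sup>2 = 4 * disc a1 a0 \<sigma> \<theta> z"
      unfolding elim by (simp add: power_mult_distrib)
    also have "\<dots> = ?g z"
      by (simp add: disc_def A_fun_def d_fun_def z_avg_def) algebra
    finally show ?case .
  qed
  with 1 have "?g has_fps_expansion complex_fps ((kernel_fps a1 a0 \<sigma> \<theta>)\<^sup>2)"
    by (subst (asm) has_fps_expansion_cong[OF _ refl]) auto
  from fps_expansion_unique_complex[OF this 2]
  have "complex_fps ((kernel_fps a1 a0 \<sigma> \<theta>)\<^sup>2) = complex_fps ?P" .
  thus ?thesis by (simp only: complex_fps_eq_iff)
qed

lemma kernel_fps_0_neg: "fps_nth (kernel_fps a1 a0 \<sigma> \<theta>) 0 < 0"
proof -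
  obtain r where r: "r > 0" "disc a1 a0 \<sigma> \<theta> 0 = of_real r" using disc_0[OF pos] by blast
  have "kernel_fun a1 a0 \<sigma> \<theta> 0 = - 2 * csqrt (disc a1 a0 \<sigma> \<theta> 0)"
    using kernel_fun_explicit[OF pos] by (rule eventually_nhds_x_imp_x)
  also have "\<dots> = of_real (- 2 * sqrt r)" using r by simp
  finally have "kernel_R a1 a0 \<sigma> \<theta> 0 = - 2 * sqrt r"
    by (simp add: kernel_R_def fps_expansion_def)
  thus ?thesis using r by (simp add: kernel_fps_def)
qed

text \<open>
  The two factors of the square are symmetric in \<open>diff_fps\<close> and \<open>avg_fps \<sigma>\<close>, and so is the
  positivity of their quotient, by inversion. One lemma thus serves both denominators.
\<close>

lemma positive_kernel_sqrt_over:
  assumes "\<sigma> \<ge> 1 / 2"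
  defines "S \<equiv> fps_const (- 1 / 2) * kernel_fps a1 a0 \<sigma> \<theta>"
  shows "positive_kernel (S * inverse (avg_fps \<sigma>))" "positive_kernel (S * inverse diff_fps)"
proof -
  let ?p = "a1 * (1 - 4 * \<theta>)" and ?q = "a0 * (1 - 4 * \<theta>) + 2"
  have S2: "(fps_const a1 * diff_fps + fps_const a0 * avg_fps \<sigma>) *
      (fps_const ?p * diff_fps + fps_const ?q * avg_fps \<sigma>) = S\<^sup>2" (is "?L = _")
  proof -
    have "S\<^sup>2 = fps_const (1 / 4) * (kernel_fps a1 a0 \<sigma> \<theta>)\<^sup>2"
      by (simp add: S_def power_mult_distrib power2_eq_square)
    also have "\<dots> = fps_const (1 / 4 * 4) * ?L"
      unfolding kernel_fps_square fps_const_mult[symmetric] by (simp only: mult.assoc)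
    finally show ?thesis by simp
  qed
  have S2': "(fps_const a0 * avg_fps \<sigma> + fps_const a1 * diff_fps) *
      (fps_const ?q * avg_fps \<sigma> + fps_const ?p * diff_fps) = S\<^sup>2"
    using S2 by (simp only: add.commute)
  have S0: "fps_nth S 0 > 0" using kernel_fps_0_neg by (simp add: S_def)
  have D0: "fps_nth diff_fps 0 > 0" "fps_nth (avg_fps \<sigma>) 0 > 0"
    using pos by (auto simp: diff_fps_def avg_fps_def)
  have nonneg: "?p \<ge> 0" "?q \<ge> 0" using pos by auto
  have u: "positive_kernel (diff_fps * inverse (avg_fps \<sigma>))"
    by (rule positive_kernel_difference_over_average) fact
  have v: "positive_kernel (avg_fps \<sigma> * inverse diff_fps)"
    using positive_kernel_quotient_swap[OF u] D0 by auto
  show "positive_kernel (S * inverse (avg_fps \<sigma>))"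
    by (rule positive_kernel_sqrt_product_over[OF u D0 _ _ _ nonneg S2 S0]) (use pos in auto)
  show "positive_kernel (S * inverse diff_fps)"
    by (rule positive_kernel_sqrt_product_over[OF v D0(2,1) _ _ _ nonneg(2,1) S2' S0])
       (use pos in auto)
qed

end

theorem proposition6:
  fixes \<rho> b c h \<tau> \<sigma> \<theta> :: real and \<Phi> :: "nat \<Rightarrow> real" and M :: nat
  assumes "\<rho> > 0" "b > 0" "c \<ge> 0" "h > 0" "\<tau> > 0"
    and "\<sigma> \<ge> 1 / 2" "\<sigma> \<noteq> sigma0 (coeff_a1 \<rho> b h \<tau>) (coeff_a0 b c h) \<theta>" "\<theta> \<le> 1 / 4"
    and "\<Phi> 0 = 0" "M \<ge> 1"
  shows "(\<Sum>m=1..M. S_ref \<rho> b c h \<tau> \<sigma> \<theta> \<Phi> m * avg \<sigma> \<Phi> m * \<tau>) \<le> 0 \<and>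
         (\<Sum>m=1..M. S_ref \<rho> b c h \<tau> \<sigma> \<theta> \<Phi> m * bdiff \<tau> \<Phi> m * \<tau>) \<le> 0"
proof -
  define a1 a0 where "a1 = coeff_a1 \<rho> b h \<tau>" and "a0 = coeff_a0 b c h"
  have pos: "a1 > 0" "a0 \<ge> 0" "\<sigma> > 0" "\<theta> \<le> 1 / 4" "\<sigma> \<noteq> sigma0 a1 a0 \<theta>"
    using assms by (auto simp: a1_def a0_def coeff_a1_def coeff_a0_def)
  define S where "S = fps_const (- 1 / 2) * kernel_fps a1 a0 \<sigma> \<theta>"
  define P where "P = Abs_fps \<Phi>"
  have D0: "fps_nth (avg_fps \<sigma>) 0 \<noteq> 0" "fps_nth diff_fps 0 \<noteq> 0"
    using pos by (auto simp: avg_fps_def diff_fps_def)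
  have "fps_nth (S * P) m = - (1 / 2) * fps_nth (kernel_fps a1 a0 \<sigma> \<theta> * P) m" for m
    by (simp add: S_def mult.assoc)
  hence S_ref: "S_ref \<rho> b c h \<tau> \<sigma> \<theta> \<Phi> m = - fps_nth (S * P) m / h" for m
    by (simp add: S_ref_def P_def kernel_fps_def fps_mult_nth a1_def a0_def)
  \<comment> \<open>The quadratic forms start at \<open>m = 0\<close>, where \<open>\<Phi> 0 = 0\<close> makes the summand vanish.\<close>
  have SP0: "fps_nth (S * P) 0 = 0" using assms(9) by (simp add: P_def)
  have drop0: "(\<Sum>m\<le>M. fps_nth (S * P) m * f m) = (\<Sum>m=1..M. fps_nth (S * P) m * f m)" for f
    by (rule sum.mono_neutral_right) (use SP0 in \<open>auto simp: not_le\<close>)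
  have "(\<Sum>m=1..M. S_ref \<rho> b c h \<tau> \<sigma> \<theta> \<Phi> m * avg \<sigma> \<Phi> m * \<tau>) =
      - (\<tau> / h) * (\<Sum>m\<le>M. fps_nth (S * P) m * fps_nth (avg_fps \<sigma> * P) m)"
    unfolding drop0 sum_distrib_left
    by (rule sum.cong) (auto simp: S_ref avg_fps_mult_nth avg_def P_def)
  moreover have "(\<Sum>m=1..M. S_ref \<rho> b c h \<tau> \<sigma> \<theta> \<Phi> m * bdiff \<tau> \<Phi> m * \<tau>) =
      - (1 / h) * (\<Sum>m\<le>M. fps_nth (S * P) m * fps_nth (diff_fps * P) m)"
    unfolding drop0 sum_distrib_left
    by (rule sum.cong) (use assms in \<open>auto simp: S_ref diff_fps_mult_nth bdiff_def P_def\<close>)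
  moreover have "0 \<le> (\<Sum>m\<le>M. fps_nth (S * P) m * fps_nth (avg_fps \<sigma> * P) m)"
    "0 \<le> (\<Sum>m\<le>M. fps_nth (S * P) m * fps_nth (diff_fps * P) m)"
    using positive_kernel_sqrt_over[OF pos assms(6), folded S_def] D0
    by (auto intro: positive_kernel_quotientD)
  ultimately show ?thesis using assms by (auto intro: mult_nonneg_nonneg divide_nonneg_nonneg)
qed

end
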